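(* Fix $\mu>0$, let $\theta_c=\theta_c(\mu)$ be the critical temperature of the thermodynamic Peierls model, and for $\theta>0$ let $\delta(\theta)\ge0$ be the $\delta$-component of the minimizer $(W,\delta)$ of $g_\theta$ over $W\ge0$, $\delta\ge0$. Then there is $C>0$ such that, as $\theta\to\theta_c$, $$\delta(\theta)=C\sqrt{(\theta_c-\theta)_+}+o\left(\sqrt{(\theta_c-\theta)_+}\right).$$
   Context: For $\mu>0$ and $\theta>0$, the thermodynamic-limit Peierls free energy per atom is, for $W\ge0$, $\delta\ge0$, $$g_\theta(W,\delta)=\frac{\mu}{2}\left[(W-1)^2+\delta^2\right]-\frac{1}{2\pi}\int_0^{2\pi}h_\theta\left(4W^2\cos^2(s)+4\delta^2\sin^2(s)\right)ds,$$ where $h_\theta(x)=2\theta\ln\big(2\cosh(\tfrac{\sqrt x}{2\theta})\big)$ for $x\ge0$. The critical temperature is $$\theta_c(\mu):=\inf\{\theta>0:\ \text{the minimizer of } g_{\theta'} \text{ has } \delta=0 \text{ for all }\theta'\ge\theta\}.$$ Notation: $(a)_+=\max\{a,0\}$. *)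

theory Defs
  imports "HOL-Analysis.Analysis" "HOL-Library.Landau_Symbols"
begin

definition peierls_h :: "real \<Rightarrow> real \<Rightarrow> real" where
  "peierls_h \<theta> x = 2 * \<theta> * ln (2 * cosh (sqrt x / (2 * \<theta>)))"

definition peierls_g :: "real \<Rightarrow> real \<Rightarrow> real \<Rightarrow> real \<Rightarrow> real" where
  "peierls_g \<mu> \<theta> W \<delta> =
     \<mu> / 2 * ((W - 1)\<^sup>2 + \<delta>\<^sup>2)
     - 1 / (2 * pi) * integral {0..2 * pi}
         (\<lambda>s. peierls_h \<theta> (4 * W\<^sup>2 * (cos s)\<^sup>2 + 4 * \<delta>\<^sup>2 * (sin s)\<^sup>2))"

definition is_peierls_minimizer :: "real \<Rightarrow> real \<Rightarrow> real \<times> real \<Rightarrow> bool" where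
  "is_peierls_minimizer \<mu> \<theta> =
     is_arg_min (\<lambda>(W, \<delta>). peierls_g \<mu> \<theta> W \<delta>) (\<lambda>(W, \<delta>). 0 \<le> W \<and> 0 \<le> \<delta>)"

(* For \<mu>, \<theta> > 0 the minimizer exists and is unique: peierls_g is coercive, and it is a strictly
   convex function of (W^2, \<delta>^2) because peierls_h is strictly concave on [0, \<infinity>). *)
definition peierls_minimizer :: "real \<Rightarrow> real \<Rightarrow> real \<times> real" where
  "peierls_minimizer \<mu> \<theta> = (THE p. is_peierls_minimizer \<mu> \<theta> p)"

definition peierls_delta :: "real \<Rightarrow> real \<Rightarrow> real" where
  "peierls_delta \<mu> \<theta> = snd (peierls_minimizer \<mu> \<theta>)"

definition critical_temperature :: "real \<Rightarrow> real" where
  "critical_temperature \<mu> = Inf {\<theta>. 0 < \<theta> \<and> (\<forall>\<theta>'\<ge>\<theta>. peierls_delta \<mu> \<theta>' = 0)}"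

end

theory Submission
  imports Defs "HOL-Real_Asymp.Real_Asymp"
begin

text \<open>
  Put \<open>T(v) = tanh \<surd>v / \<surd>v\<close>, \<open>a = (W/\<theta>)\<^sup>2\<close>, \<open>b = (\<delta>/\<theta>)\<^sup>2\<close>, and let \<open>M\<close> and \<open>N\<close> be the means over \<open>s\<close>
  of \<open>cos\<^sup>2 s T(w)\<close> and \<open>sin\<^sup>2 s T(w)\<close>, where \<open>w = a cos\<^sup>2 s + b sin\<^sup>2 s\<close>. As \<open>h\<close> is strictly concave, a pair
  satisfying the Karush-Kuhn-Tucker conditions is the unique minimizer. For \<open>\<delta> > 0\<close> these
  conditions read \<open>\<surd>a (N - M) = \<mu>/2\<close> and \<open>N = \<mu>\<theta>/2\<close>, so that \<open>\<theta>\<close> becomes a function of the curve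
  given by the first equation. On \<open>b = 0\<close> the quantity \<open>\<surd>a (N - M)\<close> increases from \<open>0\<close> to \<open>\<infinity>\<close>, hence
  takes the value \<open>\<mu>/2\<close> at a single \<open>a\<^sub>c\<close>, which determines \<open>\<theta>\<^sub>c\<close>; above \<open>\<theta>\<^sub>c\<close> the pair with \<open>\<delta> = 0\<close> is
  optimal. The Jacobian determinant of \<open>(\<surd>a (N - M), N)\<close> at \<open>(a\<^sub>c, 0)\<close> is negative, because \<open>sech\<^sup>2\<close> and \<open>- T'\<close> are
  positive and decreasing. The inverse function theorem then makes \<open>b\<close> a differentiable function of \<open>\<theta>\<close> with
  negative slope at \<open>\<theta>\<^sub>c\<close>, and \<open>\<delta> = \<theta> \<surd>b\<close> is asymptotic to a multiple of \<open>\<surd>(\<theta>\<^sub>c - \<theta>)\<close>.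
\<close>

subsection \<open>The function \<open>tanh \<surd>v / \<surd>v\<close>\<close>

text \<open>
  On \<open>v \<ge> 0\<close> this is \<open>tanh \<surd>v / \<surd>v\<close>. It is continued by its tangent line at \<open>0\<close> because the
  inverse function theorem will be applied at the boundary point \<open>\<delta> = 0\<close> and needs a function
  that is continuously differentiable on both sides of it.
\<close>
definition tanhc :: "real \<Rightarrow> real" where
  "tanhc v = (if v > 0 then tanh (sqrt v) / sqrt v else 1 - v / 3)"

definition tanhc_deriv :: "real \<Rightarrow> real" where
  "tanhc_deriv v =
     (if v > 0 then (1 - (tanh (sqrt v))\<^sup>2 - tanh (sqrt v) / sqrt v) / (2 * v) else - 1 / 3)"

lemma tanhc_power2: "u > 0 \<Longrightarrow> tanhc (u\<^sup>2) = tanh u / u"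
  by (simp add: tanhc_def)

text \<open>From the right this is the expansion \<open>tanh u / u = 1 - u^2 / 3 + ...\<close> at
  \<open>u = sqrt v\<close>; from the left the difference quotient is constant.\<close>

lemma DERIV_tanhc_0: "(tanhc has_real_derivative - 1 / 3) (at 0)"
proof -
  have "((\<lambda>v. (tanh (sqrt v) / sqrt v - 1) / v) \<longlongrightarrow> - 1 / 3) (at_right (0::real))"
    unfolding tanh_altdef by real_asymp
  then have "((\<lambda>v. (tanhc v - tanhc 0) / (v - 0)) \<longlongrightarrow> - 1 / 3) (at_right 0)"
    by (rule Lim_transform_eventually)
      (auto simp: eventually_at_right_field tanhc_def intro!: exI[of _ 1])
  moreover have "((\<lambda>v. (tanhc v - tanhc 0) / (v - 0)) \<longlongrightarrow> - 1 / 3) (at_left 0)"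
    by (rule Lim_transform_eventually[OF tendsto_const])
      (auto simp: eventually_at_left_field tanhc_def intro!: exI[of _ "-1"])
  ultimately show ?thesis
    by (auto simp: has_field_derivative_iff filterlim_split_at)
qed

lemma DERIV_tanhc: "(tanhc has_real_derivative tanhc_deriv v) (at v)"
proof -
  consider "v > 0" | "v = 0" | "v < 0" by linarith
  then show ?thesis
  proof cases
    case 1
    have "((\<lambda>v. tanh (sqrt v) / sqrt v) has_real_derivative tanhc_deriv v) (at v)"
      using 1 unfolding tanhc_deriv_def
      by (auto intro!: derivative_eq_intros simp: field_simps power2_eq_square)
    then show ?thesis
      by (rule DERIV_cong_ev[THEN iffD1, rotated -1])
        (use 1 eventually_nhds_in_open[of "{0<..}" v] in
          \<open>auto simp: tanhc_def elim!: eventually_mono\<close>)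
  next
    case 2
    then show ?thesis using DERIV_tanhc_0 by (simp add: tanhc_deriv_def)
  next
    case 3
    have "((\<lambda>v. 1 - v / 3) has_real_derivative tanhc_deriv v) (at v)"
      using 3 unfolding tanhc_deriv_def by (auto intro!: derivative_eq_intros)
    then show ?thesis
      by (rule DERIV_cong_ev[THEN iffD1, rotated -1])
        (use 3 eventually_nhds_in_open[of "{..<0}" v] in
          \<open>auto simp: tanhc_def elim!: eventually_mono\<close>)
  qed
qed

lemma isCont_tanhc_deriv: "isCont tanhc_deriv v"
proof -
  consider "v > 0" | "v = 0" | "v < 0" by linarith
  then show ?thesis
  proof cases
    case 1
    have "isCont (\<lambda>v. (1 - (tanh (sqrt v))\<^sup>2 - tanh (sqrt v) / sqrt v) / (2 * v)) v"
      using 1 by (intro continuous_intros) (auto simp: cosh_real_nonzero)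
    then show ?thesis
      by (rule isCont_cong[THEN iffD1, rotated -1])
        (use 1 eventually_nhds_in_open[of "{0<..}" v] in
          \<open>auto simp: tanhc_deriv_def elim!: eventually_mono\<close>)
  next
    case 2
    have "((\<lambda>v. (1 - (tanh (sqrt v))\<^sup>2 - tanh (sqrt v) / sqrt v) / (2 * v)) \<longlongrightarrow> - 1 / 3)
            (at_right (0::real))"
      unfolding tanh_altdef by real_asymp
    then have "(tanhc_deriv \<longlongrightarrow> tanhc_deriv 0) (at_right 0)"
      by (rule filterlim_cong[THEN iffD1, rotated -1])
        (auto simp: eventually_at_right_field tanhc_deriv_def intro!: exI[of _ 1])
    moreover have "(tanhc_deriv \<longlongrightarrow> tanhc_deriv 0) (at_left 0)"
      by (rule Lim_transform_eventually[OF tendsto_const])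
        (auto simp: eventually_at_left_field tanhc_deriv_def intro!: exI[of _ "-1"])
    ultimately show ?thesis using 2
      by (simp add: isCont_def filterlim_split_at)
  next
    case 3
    have "isCont (\<lambda>v. - 1 / 3 :: real) v" by simp
    then show ?thesis
      by (rule isCont_cong[THEN iffD1, rotated -1])
        (use 3 eventually_nhds_in_open[of "{..<0}" v] in
          \<open>auto simp: tanhc_deriv_def elim!: eventually_mono\<close>)
  qed
qed

lemma continuous_on_tanhc_deriv [continuous_intros]:
  "continuous_on S f \<Longrightarrow> continuous_on S (\<lambda>x. tanhc_deriv (f x))"
  by (rule continuous_on_compose2[of UNIV])
    (auto simp: continuous_on_eq_continuous_at isCont_tanhc_deriv)

lemma continuous_on_tanhc [continuous_intros]:
  "continuous_on S f \<Longrightarrow> continuous_on S (\<lambda>x. tanhc (f x))"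
  by (rule continuous_on_compose2[of UNIV])
    (auto simp: continuous_on_eq_continuous_at intro!: DERIV_isCont DERIV_tanhc)

text \<open>Integrate \<open>1 \<le> cosh\<close> three times. At \<open>2 * u\<close> this bounds
  \<open>sinh u * cosh u\<close> from below, which controls the sign and the monotonicity of
  \<open>tanhc_deriv\<close>.\<close>

lemma sinh_ge_cubic:
  fixes x :: real
  assumes "x \<ge> 0"
  shows "x + x ^ 3 / 6 \<le> sinh x"
proof -
  have cosh: "1 + x\<^sup>2 / 2 \<le> cosh x" if "x \<ge> 0" for x :: real
  proof -
    have sinh: "y \<le> sinh y" if "y \<ge> 0" for y :: real
      using that DERIV_nonneg_imp_nondecreasing[of 0 y "\<lambda>y. sinh y - y"]
      by (force intro!: derivative_eq_intros simp: cosh_real_ge_1)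
    show ?thesis
      using that DERIV_nonneg_imp_nondecreasing[of 0 x "\<lambda>y. cosh y - y\<^sup>2 / 2"]
      by (force intro!: derivative_eq_intros simp: sinh)
  qed
  show ?thesis
    using assms DERIV_nonneg_imp_nondecreasing[of 0 x "\<lambda>y. sinh y - y - y ^ 3 / 6"]
    by (force intro!: derivative_eq_intros simp: cosh algebra_simps)
qed

lemma sinh_ge_self: "x \<le> sinh x" if "x \<ge> 0" for x :: real
  using sinh_ge_cubic[OF that] that by (smt (verit) divide_nonneg_nonneg zero_le_power)

lemma tanh_le_self: "tanh x \<le> x" if "x \<ge> 0" for x :: real
proof -
  have "0 \<le> x - tanh x"
    using that DERIV_nonneg_imp_nondecreasing[of 0 x "\<lambda>y. y - tanh y"]
    by (force intro!: derivative_eq_intros simp: cosh_real_nonzero)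
  then show ?thesis by simp
qed

lemma one_minus_tanh_power2: "1 - (tanh u)\<^sup>2 = 1 / (cosh u)\<^sup>2" for u :: real
proof -
  have "1 - (tanh u)\<^sup>2 = ((cosh u)\<^sup>2 - (sinh u)\<^sup>2) / (cosh u)\<^sup>2"
    by (simp add: tanh_def power_divide diff_divide_distrib)
  then show ?thesis by (simp add: hyperbolic_pythagoras)
qed

text \<open>For \<open>v = u^2 > 0\<close> the claim reduces to \<open>u < sinh u * cosh u\<close>,
  that is, \<open>2 * u < sinh (2 * u)\<close>.\<close>

lemma tanhc_deriv_neg: "tanhc_deriv v < 0"
proof (cases "v > 0")
  case True
  define u where "u = sqrt v"
  have u: "u > 0" and v: "v = u\<^sup>2" using True by (auto simp: u_def)
  have "2 * u < sinh (2 * u)"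
  proof -
    have "u ^ 3 > 0" using u by simp
    moreover have "2 * u + 4 * u ^ 3 / 3 \<le> sinh (2 * u)"
      using sinh_ge_cubic[of "2*u"] u by (simp add: power_mult_distrib)
    ultimately show ?thesis by linarith
  qed
  then have "u < sinh u * cosh u" by (simp add: sinh_double)
  then have "u * (1 - (tanh u)\<^sup>2) < tanh u"
    using cosh_real_pos[of u] unfolding one_minus_tanh_power2
    by (simp add: tanh_def field_simps power2_eq_square)
  then show ?thesis
    using u True by (simp add: tanhc_deriv_def v field_simps)
qed (simp add: tanhc_deriv_def)

text \<open>This is convexity of \<open>tanhc\<close>. On \<open>v > 0\<close> the derivative is
  \<open>- R (sqrt v)\<close>, and \<open>R\<close> is shown to decrease.\<close>

lemma tanhc_deriv_mono:
  assumes "v \<le> w"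
  shows "tanhc_deriv v \<le> tanhc_deriv w"
proof -
  define R where "R = (\<lambda>u::real. (tanh u - u * (1 - (tanh u)\<^sup>2)) / (2 * u ^ 3))"
  have tR: "tanhc_deriv x = - R (sqrt x)" if "x > 0" for x
  proof -
    have "x = sqrt x ^ 2" "sqrt x > 0" using that by auto
    then show ?thesis using that unfolding tanhc_deriv_def R_def
      by (simp add: field_simps power2_eq_square power3_eq_cube)
  qed
  have R: "R y \<le> R x" if "0 < x" "x \<le> y" for x y
  proof (rule DERIV_nonpos_imp_nonincreasing[OF that(2)])
    fix u assume "x \<le> u" "u \<le> y"
    then have u: "u > 0" using that by simp
    define t where "t = tanh u"
    \<comment> \<open>The numerator of the derivative of \<open>R\<close> has the sign of
      \<open>(1 - t^2) * (2 * u^2 * t + 3 * u) - 3 * t\<close>. Multiplied by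
      \<open>(cosh u)^2\<close>, its nonpositivity is the inequality proved here from
      \<open>tanh u \<le> u\<close> and the cubic bound.\<close>
    have "tanh u * (2 * u\<^sup>2) + 3 * u \<le> u * (2 * u\<^sup>2) + 3 * u"
      using tanh_le_self[of u] u by (intro add_right_mono mult_right_mono) auto
    also have "\<dots> \<le> 3 * (sinh u * cosh u)"
      using sinh_ge_cubic[of "2*u"] u
      by (simp add: power_mult_distrib sinh_double power2_eq_square power3_eq_cube)
    finally have "(1 - t\<^sup>2) * (t * (2 * u\<^sup>2) + 3 * u) \<le> (1 - t\<^sup>2) * (3 * (sinh u * cosh u))"
      using tanh_real_bounds[of u] unfolding t_def
      by (intro mult_left_mono) (auto simp: abs_square_le_1 abs_if)
    also have "\<dots> = 3 * t"
      using cosh_real_pos[of u] unfolding t_def one_minus_tanh_power2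
      by (simp add: tanh_def field_simps power2_eq_square)
    finally have *: "(1 - t\<^sup>2) * (t * (2 * u\<^sup>2) + 3 * u) \<le> 3 * t" .
    have "(R has_real_derivative
        ((2 * u * t * (1 - t\<^sup>2)) * (2 * u ^ 3) - (t - u * (1 - t\<^sup>2)) * (6 * u\<^sup>2)) / (2 * u ^ 3)\<^sup>2) (at u)"
      unfolding R_def t_def
      using u by (auto intro!: derivative_eq_intros simp: cosh_real_nonzero)
    moreover have "(2 * u * t * (1 - t\<^sup>2)) * (2 * u ^ 3) - (t - u * (1 - t\<^sup>2)) * (6 * u\<^sup>2)
       = 2 * u\<^sup>2 * ((1 - t\<^sup>2) * (t * (2 * u\<^sup>2) + 3 * u) - 3 * t)"
      by (simp add: algebra_simps power2_eq_square power3_eq_cube)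
    ultimately show "\<exists>d. (R has_real_derivative d) (at u) \<and> d \<le> 0"
      using * by (auto intro!: exI divide_nonpos_nonneg mult_nonneg_nonpos)
  qed
  have pos: "tanhc_deriv x \<le> tanhc_deriv y" if "0 < x" "x \<le> y" for x y
    using R[of "sqrt x" "sqrt y"] that by (simp add: tR)
  \<comment> \<open>Let the smaller argument in \<open>pos\<close> tend to \<open>0\<close>.\<close>
  have zero: "- 1 / 3 \<le> tanhc_deriv y" if "0 < y" for y
  proof -
    have "(tanhc_deriv \<longlongrightarrow> tanhc_deriv 0) (at_right 0)"
      using isCont_tanhc_deriv[of 0] by (simp add: isCont_def filterlim_at_split)
    then have "tanhc_deriv 0 \<le> tanhc_deriv y"
      by (rule tendsto_upperbound) (use pos[of _ y] that in \<open>auto simp: eventually_at_right_field\<close>)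
    then show ?thesis by (simp add: tanhc_deriv_def)
  qed
  show ?thesis
    using assms pos[of v w] zero[of w] by (cases "v > 0"; cases "w > 0") (auto simp: tanhc_deriv_def)
qed

lemma tanhc_strict_antimono: "v < w \<Longrightarrow> tanhc w < tanhc v"
  using DERIV_tanhc tanhc_deriv_neg by (blast intro: DERIV_neg_imp_decreasing)

lemma tanhc_pos: "v \<ge> 0 \<Longrightarrow> 0 < tanhc v"
  by (auto simp: tanhc_def)

text \<open>With \<open>v = u^2\<close> both sides are the derivative of
  \<open>u * tanhc (u^2) = tanh u\<close>.\<close>

lemma tanhc_plus_deriv: "v \<ge> 0 \<Longrightarrow> tanhc v + 2 * v * tanhc_deriv v = 1 - (tanh (sqrt v))\<^sup>2"
  by (auto simp: tanhc_def tanhc_deriv_def field_simps)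

text \<open>Rearranged, this is \<open>u * exp (- u) \<le> sinh u\<close>, which follows from
  \<open>u \<le> sinh u\<close>.\<close>

lemma tanh_ge_rational:
  fixes u :: real assumes "u \<ge> 0"
  shows "u / (1 + u) \<le> tanh u"
proof -
  have "u * exp (- u) \<le> sinh u"
    using sinh_ge_self[OF assms] assms mult_left_le[of "exp (-u)" u] by simp
  then have "u * (cosh u - sinh u) \<le> sinh u" by (simp add: cosh_minus_sinh)
  then show ?thesis using assms cosh_real_pos[of u] by (simp add: tanh_def field_simps)
qed

subsection \<open>Means over the angle\<close>

definition angle_mean :: "(real \<Rightarrow> real) \<Rightarrow> real" where
  "angle_mean f = integral {0..2 * pi} f / (2 * pi)"

lemma angle_mean_add:
  assumes "continuous_on {0..2 * pi} f" "continuous_on {0..2 * pi} g"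
  shows "angle_mean (\<lambda>s. f s + g s) = angle_mean f + angle_mean g"
  using assms by (simp add: angle_mean_def integral_add integrable_continuous_real add_divide_distrib)

lemma angle_mean_diff:
  assumes "continuous_on {0..2 * pi} f" "continuous_on {0..2 * pi} g"
  shows "angle_mean (\<lambda>s. f s - g s) = angle_mean f - angle_mean g"
  using assms by (simp add: angle_mean_def integral_diff integrable_continuous_real diff_divide_distrib)

lemma angle_mean_cmult: "angle_mean (\<lambda>s. c * f s) = c * angle_mean f"
  by (simp add: angle_mean_def)

lemma angle_mean_nonneg:
  assumes "continuous_on {0..2 * pi} f" "\<And>s. 0 \<le> f s"
  shows "0 \<le> angle_mean f"
  using assms
  by (auto simp: angle_mean_def intro!: divide_nonneg_pos integral_nonneg integrable_continuous_real)

lemma angle_mean_pos: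
  assumes "continuous_on {0..2 * pi} f" "\<And>s. 0 \<le> f s" "s0 \<in> {0..2 * pi}" "0 < f s0"
  shows "0 < angle_mean f"
  using integral_eq_0_iff[of 0 "2 * pi" f] angle_mean_nonneg[of f] assms
  by (force simp: angle_mean_def less_le)

lemma angle_mean_less:
  assumes "continuous_on {0..2 * pi} f" "continuous_on {0..2 * pi} g"
    and "\<And>s. f s \<le> g s" "s0 \<in> {0..2 * pi}" "f s0 < g s0"
  shows "angle_mean f < angle_mean g"
proof -
  have "0 < angle_mean (\<lambda>s. g s - f s)"
    using assms by (intro angle_mean_pos[of _ s0] continuous_intros) auto
  then show ?thesis by (simp add: angle_mean_diff assms)
qed

lemma angle_mean_sin2_minus_cos2: "angle_mean (\<lambda>s. (sin s)\<^sup>2 - (cos s)\<^sup>2) = 0"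
proof -
  have "((\<lambda>s. (sin s)\<^sup>2 - (cos s)\<^sup>2) has_integral
      - (sin (2 * pi) * cos (2 * pi)) - - (sin 0 * cos 0)) {0..2 * pi}"
    by (intro fundamental_theorem_of_calculus)
      (auto intro!: derivative_eq_intros simp: power2_eq_square
        simp flip: has_real_derivative_iff_has_vector_derivative)
  then show ?thesis by (simp add: angle_mean_def integral_unique)
qed

text \<open>Chebyshev's correlation inequality: both factors decrease in \<open>cos\<^sup>2 s\<close>, and the first has mean \<open>0\<close>.\<close>
lemma angle_mean_chebyshev_strict:
  assumes "continuous_on {0..2 * pi} (\<lambda>s. f ((cos s)\<^sup>2))"
    and "\<And>c d. 0 \<le> c \<Longrightarrow> c \<le> d \<Longrightarrow> d \<le> 1 \<Longrightarrow> f d \<le> f c" and "f 1 < f (1 / 2)"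
  shows "0 < angle_mean (\<lambda>s. ((sin s)\<^sup>2 - (cos s)\<^sup>2) * f ((cos s)\<^sup>2))"
proof -
  \<comment> \<open>The factor \<open>sin^2 - cos^2 = 1 - 2 * cos^2\<close> changes sign at
    \<open>cos^2 = 1 / 2\<close>, so subtracting \<open>f (1 / 2)\<close> gives both factors the
    same sign. Strictness comes from \<open>s = 0\<close>.\<close>
  have nonneg: "0 \<le> ((sin s)\<^sup>2 - (cos s)\<^sup>2) * (f ((cos s)\<^sup>2) - f (1 / 2))" for s
  proof (cases "(cos s)\<^sup>2 \<le> 1 / 2")
    case True
    then show ?thesis using assms(2)[of "(cos s)\<^sup>2" "1 / 2"] by (auto simp: sin_squared_eq)
  next
    case False
    then show ?thesis using assms(2)[of "1 / 2" "(cos s)\<^sup>2"]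
      by (intro mult_nonpos_nonpos) (auto simp: sin_squared_eq abs_square_le_1)
  qed
  have "0 < angle_mean (\<lambda>s. ((sin s)\<^sup>2 - (cos s)\<^sup>2) * (f ((cos s)\<^sup>2) - f (1 / 2)))"
    using assms(1,3) nonneg by (intro angle_mean_pos[of _ 0] continuous_intros) auto
  also have "\<dots> = angle_mean (\<lambda>s. ((sin s)\<^sup>2 - (cos s)\<^sup>2) * f ((cos s)\<^sup>2)
                    - f (1 / 2) * ((sin s)\<^sup>2 - (cos s)\<^sup>2))"
    by (simp add: algebra_simps)
  also have "\<dots> = angle_mean (\<lambda>s. ((sin s)\<^sup>2 - (cos s)\<^sup>2) * f ((cos s)\<^sup>2))"
    using assms(1)
    by (subst angle_mean_diff)
      (auto intro!: continuous_intros simp: angle_mean_cmult angle_mean_sin2_minus_cos2)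
  finally show ?thesis .
qed

section \<open>Weighted means of \<open>tanhc\<close> and their derivatives\<close>

definition tanhc_mean :: "(real \<Rightarrow> real) \<Rightarrow> real \<times> real \<Rightarrow> real" where
  "tanhc_mean p z = angle_mean (\<lambda>s. p s * tanhc (fst z * (cos s)\<^sup>2 + snd z * (sin s)\<^sup>2))"

definition tanhc_deriv_mean :: "(real \<Rightarrow> real) \<Rightarrow> real \<times> real \<Rightarrow> real" where
  "tanhc_deriv_mean p z =
     angle_mean (\<lambda>s. p s * tanhc_deriv (fst z * (cos s)\<^sup>2 + snd z * (sin s)\<^sup>2))"

lemma continuous_on_tanhc_deriv_mean:
  assumes "continuous_on {0..2 * pi} p"
  shows "continuous_on UNIV (tanhc_deriv_mean p)"
proof -
  have "continuous_on (UNIV \<times> {0..2 * pi}) (\<lambda>z. p (snd z))"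
    by (rule continuous_on_compose2[OF assms]) (auto intro!: continuous_intros)
  then show ?thesis
    unfolding tanhc_deriv_mean_def angle_mean_def
    by (intro continuous_intros integral_continuous_on_param[of _ 0 "2 * pi", simplified])
      (auto simp: case_prod_unfold intro!: continuous_intros)
qed

text \<open>Differentiation under the integral sign. The weight \<open>p\<close> is arbitrary so
  that one argument serves both \<open>cos2_mean\<close> and \<open>sin2_mean\<close>.\<close>

lemma has_derivative_tanhc_mean:
  assumes p: "continuous_on {0..2 * pi} p"
  shows "(tanhc_mean p has_derivative (\<lambda>h. tanhc_deriv_mean (\<lambda>s. p s * (cos s)\<^sup>2) z * fst h
           + tanhc_deriv_mean (\<lambda>s. p s * (sin s)\<^sup>2) z * snd h)) (at z)"
proof -
  let ?w = "\<lambda>z s. fst z * (cos s)\<^sup>2 + snd z * (sin s)\<^sup>2"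
  let ?d = "\<lambda>z s. (p s * (cos s)\<^sup>2 * tanhc_deriv (?w z s)) *\<^sub>R fst_blinfun
              + (p s * (sin s)\<^sup>2 * tanhc_deriv (?w z s)) *\<^sub>R snd_blinfun"
  have p2: "continuous_on (UNIV \<times> {0..2 * pi}) (\<lambda>z. p (snd z))"
    by (rule continuous_on_compose2[OF p]) (auto intro!: continuous_intros)
  have deriv: "((\<lambda>z. integral (cbox 0 (2 * pi)) (\<lambda>s. p s * tanhc (?w z s))) has_derivative
          blinfun_apply (integral (cbox 0 (2 * pi)) (?d z))) (at z)"
  proof (rule leibniz_rule)
    show "((\<lambda>z. p t * tanhc (?w z t)) has_derivative blinfun_apply (?d z t)) (at z)" for z t
    proof -
      have "((\<lambda>z. tanhc (?w z t)) has_derivative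
              (\<lambda>h. tanhc_deriv (?w z t) * (fst h * (cos t)\<^sup>2 + snd h * (sin t)\<^sup>2))) (at z)"
        by (rule has_derivative_compose[OF _ DERIV_tanhc[unfolded has_field_derivative_def]])
          (auto intro!: derivative_eq_intros)
      then show ?thesis
        by (rule has_derivative_eq_rhs[OF has_derivative_mult_right])
          (auto simp: blinfun.bilinear_simps algebra_simps)
    qed
    show "continuous_on (UNIV \<times> cbox 0 (2 * pi)) (\<lambda>(z, s). ?d z s)"
      using p2 by (auto simp: case_prod_unfold intro!: continuous_intros)
  qed (use p in \<open>auto intro!: integrable_continuous_real continuous_intros\<close>)
  have "(?d z has_integral (2 * pi * tanhc_deriv_mean (\<lambda>s. p s * (cos s)\<^sup>2) z) *\<^sub>R fst_blinfun
        + (2 * pi * tanhc_deriv_mean (\<lambda>s. p s * (sin s)\<^sup>2) z) *\<^sub>R snd_blinfun) {0..2 * pi}"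
    using p unfolding tanhc_deriv_mean_def angle_mean_def
    by (intro has_integral_add has_integral_scaleR_left)
      (auto intro!: integrable_integral integrable_continuous_real continuous_intros)
  from integral_unique[OF this] have integral: "integral (cbox 0 (2 * pi)) (?d z)
      = (2 * pi * tanhc_deriv_mean (\<lambda>s. p s * (cos s)\<^sup>2) z) *\<^sub>R fst_blinfun
        + (2 * pi * tanhc_deriv_mean (\<lambda>s. p s * (sin s)\<^sup>2) z) *\<^sub>R snd_blinfun"
    by simp
  have "((\<lambda>z. integral {0..2 * pi} (\<lambda>s. p s * tanhc (?w z s)) / (2 * pi)) has_derivative
      (\<lambda>h. (2 * pi * tanhc_deriv_mean (\<lambda>s. p s * (cos s)\<^sup>2) z * fst h
        + 2 * pi * tanhc_deriv_mean (\<lambda>s. p s * (sin s)\<^sup>2) z * snd h) / (2 * pi))) (at z)"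
    using bounded_linear.has_derivative[OF bounded_linear_divide[of "2 * pi"] deriv[unfolded integral]]
    by (simp add: blinfun.bilinear_simps)
  then show ?thesis
    by (simp add: tanhc_mean_def[abs_def] angle_mean_def add_divide_distrib)
qed

subsection \<open>Sufficient optimality conditions\<close>

text \<open>Strict concavity: the derivative \<open>tanhc w / 2\<close> is strictly decreasing. The
  mean value theorem uses it only at interior points, so \<open>v = 0\<close> and
  \<open>w = 0\<close> are covered.\<close>

lemma ln_cosh_sqrt_tangent:
  fixes v w :: real
  assumes "0 \<le> v" "0 \<le> w" "v \<noteq> w"
  shows "ln (2 * cosh (sqrt w)) < ln (2 * cosh (sqrt v)) + tanhc v / 2 * (w - v)"
proof -
  let ?H = "\<lambda>w::real. ln (2 * cosh (sqrt w))"
  have deriv: "(?H has_real_derivative tanhc x / 2) (at x)" if "x > 0" for x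
    using that by (auto intro!: derivative_eq_intros simp: tanhc_def tanh_def cosh_real_pos field_simps)
  have diff: "?H differentiable at x" if "x > 0" for x
    using deriv[OF that] by (auto simp: real_differentiable_def)
  have cont: "continuous_on {a..b} ?H" for a b
    by (intro continuous_intros) (auto simp: cosh_real_pos less_imp_neq[symmetric])
  show ?thesis
  proof (cases "v < w")
    case True
    then obtain l z where z: "v < z" "z < w" "DERIV ?H z :> l" "?H w - ?H v = (w - v) * l"
      using MVT[OF True cont diff] assms by force
    then have "l < tanhc v / 2"
      using DERIV_unique[OF z(3) deriv] tanhc_strict_antimono[of v z] assms by simp
    then have "(w - v) * l < (w - v) * (tanhc v / 2)" using True by simp
    then show ?thesis using z(4) by (simp add: mult.commute)
  next
    case False
    then have "w < v" using assms by simp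
    then obtain l z where z: "w < z" "z < v" "DERIV ?H z :> l" "?H v - ?H w = (v - w) * l"
      using MVT[OF \<open>w < v\<close> cont diff] assms by force
    then have "tanhc v / 2 < l"
      using DERIV_unique[OF z(3) deriv] tanhc_strict_antimono[of z v] assms by simp
    then have "(v - w) * (tanhc v / 2) < (v - w) * l" using \<open>w < v\<close> by simp
    moreover have "tanhc v / 2 * (w - v) = - ((v - w) * (tanhc v / 2))" by (simp add: field_simps)
    ultimately show ?thesis using z(4) by linarith
  qed
qed

text \<open>In the rescaled unknowns \<open>a = (W / \<theta>)\<^sup>2\<close>, \<open>b = (\<delta> / \<theta>)\<^sup>2\<close> the two partial derivatives of
  the integral in \<open>peierls_g\<close> are, up to elementary factors, \<open>cos2_mean (a, b)\<close> and \<open>sin2_mean (a, b)\<close>.\<close>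
definition cos2_mean :: "real \<times> real \<Rightarrow> real" where
  "cos2_mean = tanhc_mean (\<lambda>s. (cos s)\<^sup>2)"

definition sin2_mean :: "real \<times> real \<Rightarrow> real" where
  "sin2_mean = tanhc_mean (\<lambda>s. (sin s)\<^sup>2)"

lemma peierls_g_eq:
  assumes "\<theta> > 0"
  shows "peierls_g \<mu> \<theta> (\<theta> * x) (\<theta> * y) = \<mu> / 2 * ((\<theta> * x - 1)\<^sup>2 + (\<theta> * y)\<^sup>2)
    - 2 * \<theta> * angle_mean (\<lambda>s. ln (2 * cosh (sqrt (x\<^sup>2 * (cos s)\<^sup>2 + y\<^sup>2 * (sin s)\<^sup>2))))"
proof -
  have "sqrt (4 * (\<theta> * x)\<^sup>2 * (cos s)\<^sup>2 + 4 * (\<theta> * y)\<^sup>2 * (sin s)\<^sup>2) / (2 * \<theta>)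
     = sqrt (x\<^sup>2 * (cos s)\<^sup>2 + y\<^sup>2 * (sin s)\<^sup>2)" for s
  proof -
    have "4 * (\<theta> * x)\<^sup>2 * (cos s)\<^sup>2 + 4 * (\<theta> * y)\<^sup>2 * (sin s)\<^sup>2
      = (2 * \<theta>)\<^sup>2 * (x\<^sup>2 * (cos s)\<^sup>2 + y\<^sup>2 * (sin s)\<^sup>2)"
      by (simp add: power_mult_distrib algebra_simps)
    then show ?thesis using assms by (simp only: real_sqrt_mult real_sqrt_abs) simp
  qed
  then show ?thesis
    by (simp add: peierls_g_def peierls_h_def angle_mean_def)
qed

text \<open>The tangent inequality for \<open>ln (2 * cosh (sqrt w))\<close> is averaged over the
  angle, while the quadratic part of the energy is kept exactly.\<close>

lemma peierls_g_tangent: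
  assumes "\<theta> > 0" "0 \<le> x" "0 \<le> y" "0 \<le> x'" "0 \<le> y'" "(x', y') \<noteq> (x, y)"
  shows "peierls_g \<mu> \<theta> (\<theta> * x) (\<theta> * y)
      + \<mu> / 2 * ((\<theta> * x' - 1)\<^sup>2 - (\<theta> * x - 1)\<^sup>2 + (\<theta> * y')\<^sup>2 - (\<theta> * y)\<^sup>2)
      - \<theta> * ((x'\<^sup>2 - x\<^sup>2) * cos2_mean (x\<^sup>2, y\<^sup>2) + (y'\<^sup>2 - y\<^sup>2) * sin2_mean (x\<^sup>2, y\<^sup>2))
    < peierls_g \<mu> \<theta> (\<theta> * x') (\<theta> * y')"
proof -
  let ?w = "\<lambda>x y s. x\<^sup>2 * (cos s)\<^sup>2 + y\<^sup>2 * (sin s)\<^sup>2 :: real"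
  let ?H = "\<lambda>w. ln (2 * cosh (sqrt w))"
  have contH: "continuous_on {0..2 * pi} (\<lambda>s. ?H (?w x y s))" for x y
    by (intro continuous_intros) (auto simp: cosh_real_pos less_imp_neq[symmetric])
  have le: "?H (?w x' y' s) \<le> ?H (?w x y s) + tanhc (?w x y s) / 2 * (?w x' y' s - ?w x y s)" for s
    using ln_cosh_sqrt_tangent[of "?w x y s" "?w x' y' s"]
    by (cases "?w x y s = ?w x' y' s") auto
  \<comment> \<open>By continuity one angle with strict inequality suffices: \<open>s = 0\<close>
    sees only \<open>x\<close>, and \<open>s = pi / 2\<close> sees only \<open>y\<close>.\<close>
  obtain s0 where s0: "s0 \<in> {0..2 * pi}" "?w x y s0 \<noteq> ?w x' y' s0"
  proof (cases "x = x'")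
    case True
    then have "y\<^sup>2 \<noteq> y'\<^sup>2" using assms by auto
    then show ?thesis using that[of "pi / 2"] by simp
  next
    case False
    then have "x\<^sup>2 \<noteq> x'\<^sup>2" using assms by auto
    then show ?thesis using that[of 0] by simp
  qed
  have "angle_mean (\<lambda>s. ?H (?w x' y' s))
      < angle_mean (\<lambda>s. ?H (?w x y s) + tanhc (?w x y s) / 2 * (?w x' y' s - ?w x y s))"
    using s0 ln_cosh_sqrt_tangent[of "?w x y s0" "?w x' y' s0"] le
    by (intro angle_mean_less[of _ _ s0]) (auto intro!: contH continuous_intros)
  also have "\<dots> = angle_mean (\<lambda>s. ?H (?w x y s) + ((x'\<^sup>2 - x\<^sup>2) / 2 * ((cos s)\<^sup>2 * tanhc (?w x y s))
      + (y'\<^sup>2 - y\<^sup>2) / 2 * ((sin s)\<^sup>2 * tanhc (?w x y s))))"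
    by (rule arg_cong[of _ _ angle_mean]) (auto simp: fun_eq_iff field_simps)
  also have "\<dots> = angle_mean (\<lambda>s. ?H (?w x y s)) + ((x'\<^sup>2 - x\<^sup>2) / 2 * cos2_mean (x\<^sup>2, y\<^sup>2)
      + (y'\<^sup>2 - y\<^sup>2) / 2 * sin2_mean (x\<^sup>2, y\<^sup>2))"
    by (subst angle_mean_add angle_mean_cmult;
        (intro contH continuous_intros)?)+
      (simp add: cos2_mean_def sin2_mean_def tanhc_mean_def)
  finally have "2 * \<theta> * angle_mean (\<lambda>s. ?H (?w x' y' s)) < 2 * \<theta> * (angle_mean (\<lambda>s. ?H (?w x y s))
      + ((x'\<^sup>2 - x\<^sup>2) / 2 * cos2_mean (x\<^sup>2, y\<^sup>2) + (y'\<^sup>2 - y\<^sup>2) / 2 * sin2_mean (x\<^sup>2, y\<^sup>2)))"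
    using assms(1) by simp
  then show ?thesis
    by (simp add: peierls_g_eq[OF assms(1)] algebra_simps diff_divide_distrib)
qed

text \<open>The hypotheses are stationarity in \<open>x\<close> and complementarity in
  \<open>y\<close>. With them the correction term of the tangent bound is nonnegative, so every
  other admissible point has strictly larger energy; this also gives the uniqueness required by
  \<open>THE\<close>.\<close>

lemma peierls_minimizer_eq:
  assumes "\<mu> > 0" "\<theta> > 0" "x > 0" "y \<ge> 0"
    and x: "\<mu> * (\<theta> * x - 1) = 2 * x * cos2_mean (x\<^sup>2, y\<^sup>2)"
    and y: "2 * sin2_mean (x\<^sup>2, y\<^sup>2) \<le> \<mu> * \<theta>" "y = 0 \<or> 2 * sin2_mean (x\<^sup>2, y\<^sup>2) = \<mu> * \<theta>"
  shows "peierls_minimizer \<mu> \<theta> = (\<theta> * x, \<theta> * y)"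
proof -
  have less: "peierls_g \<mu> \<theta> (\<theta> * x) (\<theta> * y) < peierls_g \<mu> \<theta> W \<delta>"
    if "0 \<le> W" "0 \<le> \<delta>" "(W, \<delta>) \<noteq> (\<theta> * x, \<theta> * y)" for W \<delta>
  proof -
    define x' y' where xy': "x' = W / \<theta>" "y' = \<delta> / \<theta>"
    then have W: "W = \<theta> * x'" "\<delta> = \<theta> * y'" using assms by auto
    have "0 \<le> \<theta> * (y'\<^sup>2 - y\<^sup>2) * (\<mu> * \<theta> / 2 - sin2_mean (x\<^sup>2, y\<^sup>2))"
    proof (cases "y = 0")
      case False
      then have "sin2_mean (x\<^sup>2, y\<^sup>2) = \<mu> * \<theta> / 2" using y(2) by simp
      then show ?thesis by (simp only:) simp
    qed (use y assms(2) in auto)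
    moreover have M: "cos2_mean (x\<^sup>2, y\<^sup>2) = \<mu> * (\<theta> * x - 1) / (2 * x)"
      using x assms(3) by (simp add: field_simps)
    \<comment> \<open>Once stationarity has eliminated \<open>cos2_mean\<close>, the
      \<open>x\<close> part is a perfect square.\<close>
    have "\<mu> / 2 * ((\<theta> * x' - 1)\<^sup>2 - (\<theta> * x - 1)\<^sup>2) - \<theta> * ((x'\<^sup>2 - x\<^sup>2) * cos2_mean (x\<^sup>2, y\<^sup>2))
        = \<mu> * \<theta> / (2 * x) * (x' - x)\<^sup>2"
      unfolding M using assms(3) by (simp add: field_simps power2_eq_square)
    then have "0 \<le> \<mu> / 2 * ((\<theta> * x' - 1)\<^sup>2 - (\<theta> * x - 1)\<^sup>2) - \<theta> * ((x'\<^sup>2 - x\<^sup>2) * cos2_mean (x\<^sup>2, y\<^sup>2))"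
      using assms by simp
    ultimately have "0 \<le> \<mu> / 2 * ((\<theta> * x' - 1)\<^sup>2 - (\<theta> * x - 1)\<^sup>2 + (\<theta> * y')\<^sup>2 - (\<theta> * y)\<^sup>2)
      - \<theta> * ((x'\<^sup>2 - x\<^sup>2) * cos2_mean (x\<^sup>2, y\<^sup>2) + (y'\<^sup>2 - y\<^sup>2) * sin2_mean (x\<^sup>2, y\<^sup>2))"
      by (simp add: algebra_simps power2_eq_square)
    moreover have "0 \<le> x'" "0 \<le> y'" "(x', y') \<noteq> (x, y)"
      using that assms(2) by (auto simp: xy')
    ultimately show ?thesis
      using peierls_g_tangent[of \<theta> x y x' y' \<mu>] assms(2,3,4) unfolding W by linarith
  qed
  show ?thesis
    unfolding peierls_minimizer_def
  proof (rule the_equality)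
    show "is_peierls_minimizer \<mu> \<theta> (\<theta> * x, \<theta> * y)"
      using less assms unfolding is_peierls_minimizer_def is_arg_min_def
      by (force simp: less_imp_le not_less)
    show "p = (\<theta> * x, \<theta> * y)" if "is_peierls_minimizer \<mu> \<theta> p" for p
      using less[of "fst p" "snd p"] that assms unfolding is_peierls_minimizer_def is_arg_min_def
      by (auto simp: case_prod_unfold)
  qed
qed

subsection \<open>The Euler equations\<close>

text \<open>Eliminating \<open>\<theta>\<close> from the Euler equations \<open>\<mu> (\<theta> \<surd>a - 1) = 2 \<surd>a \<cdot> cos2_mean (a, b)\<close> and
  \<open>\<mu> \<theta> = 2 sin2_mean (a, b)\<close> leaves \<open>gap (a, b) = \<mu> / 2\<close>. The suffixes \<open>dx\<close> and \<open>dy\<close> stand for the partial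
  derivatives in \<open>a\<close> and \<open>b\<close>.\<close>
definition gap :: "real \<times> real \<Rightarrow> real" where
  "gap z = sqrt (fst z) * (sin2_mean z - cos2_mean z)"

definition gap_dx :: "real \<times> real \<Rightarrow> real" where
  "gap_dx z = (sin2_mean z - cos2_mean z) / (2 * sqrt (fst z))
     + sqrt (fst z) * (tanhc_deriv_mean (\<lambda>s. (sin s)\<^sup>2 * (cos s)\<^sup>2) z
         - tanhc_deriv_mean (\<lambda>s. (cos s)\<^sup>2 * (cos s)\<^sup>2) z)"

definition gap_dy :: "real \<times> real \<Rightarrow> real" where
  "gap_dy z = sqrt (fst z) * (tanhc_deriv_mean (\<lambda>s. (sin s)\<^sup>2 * (sin s)\<^sup>2) z
         - tanhc_deriv_mean (\<lambda>s. (cos s)\<^sup>2 * (sin s)\<^sup>2) z)"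

definition sin2_dx :: "real \<times> real \<Rightarrow> real" where
  "sin2_dx = tanhc_deriv_mean (\<lambda>s. (sin s)\<^sup>2 * (cos s)\<^sup>2)"

definition sin2_dy :: "real \<times> real \<Rightarrow> real" where
  "sin2_dy = tanhc_deriv_mean (\<lambda>s. (sin s)\<^sup>2 * (sin s)\<^sup>2)"

lemma has_derivative_sin2_mean:
  "(sin2_mean has_derivative (\<lambda>h. sin2_dx z * fst h + sin2_dy z * snd h)) (at z)"
  unfolding sin2_mean_def sin2_dx_def sin2_dy_def
  by (rule has_derivative_tanhc_mean) (intro continuous_intros)

lemma has_derivative_cos2_mean:
  "(cos2_mean has_derivative (\<lambda>h. tanhc_deriv_mean (\<lambda>s. (cos s)\<^sup>2 * (cos s)\<^sup>2) z * fst h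
     + tanhc_deriv_mean (\<lambda>s. (cos s)\<^sup>2 * (sin s)\<^sup>2) z * snd h)) (at z)"
  unfolding cos2_mean_def
  by (rule has_derivative_tanhc_mean) (intro continuous_intros)

lemma continuous_on_sin2_mean [continuous_intros]:
  "continuous_on S f \<Longrightarrow> continuous_on S (\<lambda>x. sin2_mean (f x))"
  by (rule continuous_on_compose2[of UNIV])
    (auto simp: continuous_on_eq_continuous_at intro!: has_derivative_continuous has_derivative_sin2_mean)

lemma continuous_on_cos2_mean [continuous_intros]:
  "continuous_on S f \<Longrightarrow> continuous_on S (\<lambda>x. cos2_mean (f x))"
  by (rule continuous_on_compose2[of UNIV])
    (auto simp: continuous_on_eq_continuous_at intro!: has_derivative_continuous has_derivative_cos2_mean)

lemma has_derivative_gap: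
  assumes "fst z > 0"
  shows "(gap has_derivative (\<lambda>h. gap_dx z * fst h + gap_dy z * snd h)) (at z)"
proof -
  have "((\<lambda>z. sqrt (fst z)) has_derivative (\<lambda>h. fst h / (2 * sqrt (fst z)))) (at z)"
    using assms by (auto intro!: derivative_eq_intros simp: field_simps)
  from has_derivative_mult[OF this has_derivative_diff[OF has_derivative_sin2_mean has_derivative_cos2_mean]]
  show ?thesis
    unfolding gap_def[abs_def] gap_dx_def gap_dy_def sin2_dx_def sin2_dy_def
    by (rule has_derivative_eq_rhs) (auto simp: algebra_simps add_divide_distrib)
qed

lemma continuous_on_gap_dx: "continuous_on {z. fst z > 0} gap_dx"
  unfolding gap_dx_def[abs_def]
  by (intro continuous_intros continuous_on_subset[OF continuous_on_tanhc_deriv_mean]) auto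

lemma continuous_on_gap_dy: "continuous_on {z. fst z > 0} gap_dy"
  unfolding gap_dy_def[abs_def]
  by (intro continuous_intros continuous_on_subset[OF continuous_on_tanhc_deriv_mean]) auto

lemma continuous_on_sin2_dx: "continuous_on S sin2_dx"
  unfolding sin2_dx_def
  by (intro continuous_intros continuous_on_subset[OF continuous_on_tanhc_deriv_mean]) auto

lemma continuous_on_sin2_dy: "continuous_on S sin2_dy"
  unfolding sin2_dy_def
  by (intro continuous_intros continuous_on_subset[OF continuous_on_tanhc_deriv_mean]) auto

section \<open>Signs of the partial derivatives on the axis \<open>b = 0\<close>\<close>

lemma sin2_mean_minus_cos2_mean:
  "sin2_mean z - cos2_mean z =
     angle_mean (\<lambda>s. ((sin s)\<^sup>2 - (cos s)\<^sup>2) * tanhc (fst z * (cos s)\<^sup>2 + snd z * (sin s)\<^sup>2))"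
  unfolding sin2_mean_def cos2_mean_def tanhc_mean_def
  by (subst angle_mean_diff[symmetric]) (auto intro!: continuous_intros simp: left_diff_distrib)

text \<open>After multiplication by \<open>2 * sqrt a\<close> this is the mean of
  \<open>sin^2 - cos^2\<close> against \<open>f c = sech^2 (sqrt (a * c))\<close>, by
  \<open>tanhc_plus_deriv\<close>. As \<open>f\<close> decreases, Chebyshev's inequality
  applies.\<close>

lemma gap_dx_pos:
  assumes "a > 0"
  shows "gap_dx (a, 0) > 0"
proof -
  let ?f = "\<lambda>c. 1 - (tanh (sqrt (a * c)))\<^sup>2"
  have f: "?f c = tanhc (a * c) + 2 * (a * c) * tanhc_deriv (a * c)" if "c \<ge> 0" for c
    using tanhc_plus_deriv[of "a * c"] that assms by simp
  have "0 < angle_mean (\<lambda>s. ((sin s)\<^sup>2 - (cos s)\<^sup>2) * ?f ((cos s)\<^sup>2))"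
  proof (rule angle_mean_chebyshev_strict)
    show "continuous_on {0..2 * pi} (\<lambda>s. ?f ((cos s)\<^sup>2))"
      by (intro continuous_intros) (auto simp: cosh_real_nonzero)
    show "?f d \<le> ?f c" if "0 \<le> c" "c \<le> d" "d \<le> 1" for c d
      using that assms by (auto intro!: power_mono)
    show "?f 1 < ?f (1 / 2)"
      using assms by (auto intro!: power_strict_mono)
  qed
  also have "\<dots> = angle_mean (\<lambda>s. ((sin s)\<^sup>2 - (cos s)\<^sup>2) * tanhc (a * (cos s)\<^sup>2)
      + 2 * a * ((sin s)\<^sup>2 * (cos s)\<^sup>2 * tanhc_deriv (a * (cos s)\<^sup>2)
        - (cos s)\<^sup>2 * (cos s)\<^sup>2 * tanhc_deriv (a * (cos s)\<^sup>2)))"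
    by (subst f) (auto simp: algebra_simps)
  also have "\<dots> = (sin2_mean (a, 0) - cos2_mean (a, 0))
      + 2 * a * (tanhc_deriv_mean (\<lambda>s. (sin s)\<^sup>2 * (cos s)\<^sup>2) (a, 0)
         - tanhc_deriv_mean (\<lambda>s. (cos s)\<^sup>2 * (cos s)\<^sup>2) (a, 0))"
    unfolding sin2_mean_minus_cos2_mean tanhc_deriv_mean_def
    by (subst angle_mean_add angle_mean_cmult angle_mean_diff; (intro continuous_intros)?)+ simp
  also have "\<dots> = 2 * sqrt a * gap_dx (a, 0)"
  proof -
    have "X + 2 * r\<^sup>2 * D = 2 * r * (X / (2 * r) + r * D)" if "r > 0" for r X D :: real
      using that by (simp add: field_simps power2_eq_square)
    from this[of "sqrt a"] show ?thesis
      using assms by (simp add: gap_dx_def)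
  qed
  finally show ?thesis using assms by (simp add: zero_less_mult_iff)
qed

text \<open>Writing \<open>sin^2 = 1 - c\<close> turns \<open>- gap_dy / sqrt a\<close> into a
  Chebyshev mean with \<open>f c = (1 - c) * - tanhc_deriv (a * c)\<close>, a product of nonnegative
  decreasing factors.\<close>

lemma gap_dy_neg:
  assumes "a > 0"
  shows "gap_dy (a, 0) < 0"
proof -
  let ?f = "\<lambda>c. (1 - c) * - tanhc_deriv (a * c)"
  have "0 < angle_mean (\<lambda>s. ((sin s)\<^sup>2 - (cos s)\<^sup>2) * ?f ((cos s)\<^sup>2))"
  proof (rule angle_mean_chebyshev_strict)
    show "continuous_on {0..2 * pi} (\<lambda>s. ?f ((cos s)\<^sup>2))"
      by (intro continuous_intros)
    show "?f d \<le> ?f c" if "0 \<le> c" "c \<le> d" "d \<le> 1" for c d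
      using that assms tanhc_deriv_mono[of "a * c" "a * d"] tanhc_deriv_neg[of "a * d"]
      by (intro mult_mono) auto
    show "?f 1 < ?f (1 / 2)"
      using tanhc_deriv_neg[of "a * (1 / 2)"] by simp
  qed
  also have "\<dots> = angle_mean (\<lambda>s. (cos s)\<^sup>2 * (sin s)\<^sup>2 * tanhc_deriv (a * (cos s)\<^sup>2)
        - (sin s)\<^sup>2 * (sin s)\<^sup>2 * tanhc_deriv (a * (cos s)\<^sup>2))"
    by (rule arg_cong[of _ _ angle_mean]) (simp add: fun_eq_iff algebra_simps flip: sin_squared_eq)
  also have "\<dots> = tanhc_deriv_mean (\<lambda>s. (cos s)\<^sup>2 * (sin s)\<^sup>2) (a, 0)
         - tanhc_deriv_mean (\<lambda>s. (sin s)\<^sup>2 * (sin s)\<^sup>2) (a, 0)"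
    unfolding tanhc_deriv_mean_def
    by (subst angle_mean_diff; (intro continuous_intros)?) simp
  finally show ?thesis
    using assms by (simp add: gap_dy_def mult_pos_neg)
qed

lemma tanhc_deriv_mean_neg:
  assumes "continuous_on {0..2 * pi} p" "\<And>s. 0 \<le> p s" "s0 \<in> {0..2 * pi}" "0 < p s0"
  shows "tanhc_deriv_mean p z < 0"
proof -
  have "0 < angle_mean (\<lambda>s. p s * - tanhc_deriv (fst z * (cos s)\<^sup>2 + snd z * (sin s)\<^sup>2))"
    using assms tanhc_deriv_neg
    by (intro angle_mean_pos[of _ s0] continuous_intros) (auto simp: less_imp_le mult_nonneg_nonpos mult_pos_neg)
  also have "\<dots> = - tanhc_deriv_mean p z"
    using angle_mean_cmult[of "-1"] by (simp add: tanhc_deriv_mean_def)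
  finally show ?thesis by simp
qed

lemma sin2_dx_neg: "sin2_dx z < 0"
  unfolding sin2_dx_def
proof (rule tanhc_deriv_mean_neg[of _ "pi / 4"])
qed (auto intro!: continuous_intros simp: sin_45 cos_45)

lemma sin2_dy_neg: "sin2_dy z < 0"
  unfolding sin2_dy_def
proof (rule tanhc_deriv_mean_neg[of _ "pi / 2"])
qed (auto intro!: continuous_intros)

lemma sin2_mean_pos: "0 \<le> a \<Longrightarrow> 0 < sin2_mean (a, 0)"
  unfolding sin2_mean_def tanhc_mean_def
  by (rule angle_mean_pos[of _ "pi / 2"])
    (auto intro!: continuous_intros mult_nonneg_nonneg less_imp_le[OF tanhc_pos] simp: tanhc_pos)

lemma cos2_mean_nonneg: "0 \<le> a \<Longrightarrow> 0 \<le> cos2_mean (a, 0)"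
  unfolding cos2_mean_def tanhc_mean_def
  by (rule angle_mean_nonneg)
    (auto intro!: continuous_intros mult_nonneg_nonneg less_imp_le[OF tanhc_pos])

lemma gap_mono:
  assumes "0 < a" "a \<le> b"
  shows "gap (a, 0) \<le> gap (b, 0)"
proof (rule DERIV_nonneg_imp_nondecreasing[OF assms(2)])
  fix x assume "a \<le> x" "x \<le> b"
  then have x: "x > 0" using assms by simp
  have "((\<lambda>x. (x, 0 :: real)) has_derivative (\<lambda>h. (h, 0))) (at x)"
    by (auto intro!: derivative_eq_intros)
  from has_derivative_compose[OF this has_derivative_gap] x
  have "((\<lambda>x. gap (x, 0)) has_real_derivative gap_dx (x, 0)) (at x)"
    by (simp add: has_field_derivative_def)
  then show "\<exists>d. ((\<lambda>x. gap (x, 0)) has_real_derivative d) (at x) \<and> 0 \<le> d"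
    using gap_dx_pos[OF x] by (auto intro: less_imp_le)
qed

text \<open>The logarithm comes from the non-integrable singularity of \<open>1 / \<bar>cos s\<bar>\<close> at \<open>pi / 2\<close>.\<close>
lemma gap_lower_bound:
  assumes "t > 0"
  shows "ln (1 + t) / (2 * pi) - 2 \<le> gap (t\<^sup>2, 0)"
proof -
  have tanhc_ge: "1 / (1 + u) \<le> tanhc (u\<^sup>2)" if "u \<ge> 0" for u
  proof (cases "u = 0")
    case False
    then show ?thesis using tanh_ge_rational[of u] that by (simp add: tanhc_power2 field_simps)
  qed (simp add: tanhc_def)
  let ?T = "\<lambda>s. tanhc (t\<^sup>2 * (cos s)\<^sup>2)"
  have T: "?T s = tanhc ((t * \<bar>cos s\<bar>)\<^sup>2)" for s
    by (simp add: power_mult_distrib)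
  have "((\<lambda>s. t / (1 + t * (s - pi / 2))) has_integral
      ln (1 + t * (pi / 2 + 1 - pi / 2)) - ln (1 + t * (pi / 2 - pi / 2))) {pi / 2..pi / 2 + 1}"
    by (rule fundamental_theorem_of_calculus)
      (use assms in \<open>auto intro!: derivative_eq_intros add_pos_nonneg
        simp flip: has_real_derivative_iff_has_vector_derivative\<close>)
  then have int: "((\<lambda>s. t / (1 + t * (s - pi / 2))) has_integral ln (1 + t)) {pi / 2..pi / 2 + 1}"
    by simp
  have "ln (1 + t) \<le> integral {pi / 2..pi / 2 + 1} (\<lambda>s. t * ?T s)"
  \<comment> \<open>On this interval \<open>\<bar>cos s\<bar> \<le> s - pi / 2\<close>, so the
    integrand dominates one with the explicit integral \<open>ln (1 + t)\<close>.\<close>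
  proof (rule has_integral_le[OF int integrable_integral])
    show "(\<lambda>s. t * ?T s) integrable_on {pi / 2..pi / 2 + 1}"
      by (intro integrable_continuous_real continuous_intros)
    fix s assume s: "s \<in> {pi / 2..pi / 2 + 1}"
    have "\<bar>cos s\<bar> \<le> s - pi / 2"
      using abs_sin_x_le_abs_x[of "pi / 2 - s"] s by (simp add: cos_sin_eq)
    then have "1 / (1 + t * (s - pi / 2)) \<le> 1 / (1 + t * \<bar>cos s\<bar>)"
      using assms by (intro divide_left_mono mult_left_mono add_left_mono) (auto intro!: mult_pos_pos add_pos_nonneg)
    also have "\<dots> \<le> ?T s"
      unfolding T using assms by (intro tanhc_ge) simp
    finally show "t / (1 + t * (s - pi / 2)) \<le> t * ?T s"
      using mult_left_mono[of _ _ t] assms by fastforce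
  qed
  also have "\<dots> \<le> integral {0..2 * pi} (\<lambda>s. t * ?T s)"
    using assms pi_gt3
    by (intro integral_subset_le integrable_continuous_real continuous_intros)
      (auto intro!: mult_nonneg_nonneg less_imp_le[OF tanhc_pos])
  finally have 1: "ln (1 + t) / (2 * pi) \<le> angle_mean (\<lambda>s. t * ?T s)"
    by (simp add: angle_mean_def divide_right_mono)
  \<comment> \<open>The factor \<open>cos^2\<close> cancels the singularity: the product is
    \<open>\<bar>cos s\<bar> * tanh (t * \<bar>cos s\<bar>)\<close>. Since
    \<open>sin^2 - cos^2 = 1 - 2 * cos^2\<close>, this part costs at most \<open>2\<close>.\<close>
  have "t * ((cos s)\<^sup>2 * ?T s) \<le> 1" for s
  proof (cases "cos s = 0")
    case False
    then have "?T s = tanh (t * \<bar>cos s\<bar>) / (t * \<bar>cos s\<bar>)"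
      using assms unfolding T by (intro tanhc_power2) simp
    moreover have "(cos s)\<^sup>2 = \<bar>cos s\<bar> * \<bar>cos s\<bar>" by (simp add: power2_eq_square)
    ultimately have "t * ((cos s)\<^sup>2 * ?T s) = \<bar>cos s\<bar> * tanh (t * \<bar>cos s\<bar>)"
      using assms False by (simp del: tanh_real_abs abs_mult_self_eq)
    also have "\<dots> \<le> 1 * 1"
      using tanh_real_lt_1[of "t * \<bar>cos s\<bar>"] assms
      by (intro mult_mono) (auto simp del: tanh_real_abs)
    finally show ?thesis by simp
  qed simp
  then have "0 \<le> angle_mean (\<lambda>s. 2 - 2 * (t * ((cos s)\<^sup>2 * ?T s)))"
    by (intro angle_mean_nonneg continuous_intros) auto
  also have "\<dots> = 2 - 2 * (t * cos2_mean (t\<^sup>2, 0))"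
    unfolding cos2_mean_def tanhc_mean_def
    by (subst angle_mean_diff angle_mean_cmult; (intro continuous_intros)?)+ (simp add: angle_mean_def)
  finally have 2: "2 * (t * cos2_mean (t\<^sup>2, 0)) \<le> 2" by simp
  have "gap (t\<^sup>2, 0) = t * angle_mean (\<lambda>s. ?T s - 2 * ((cos s)\<^sup>2 * ?T s))"
    unfolding gap_def sin2_mean_minus_cos2_mean using assms
    by (simp add: sin_squared_eq algebra_simps)
  also have "\<dots> = angle_mean (\<lambda>s. t * ?T s) - 2 * (t * cos2_mean (t\<^sup>2, 0))"
    unfolding cos2_mean_def tanhc_mean_def
    by (subst angle_mean_diff angle_mean_cmult; (intro continuous_intros)?)+ (simp add: angle_mean_cmult algebra_simps)
  finally show ?thesis using 1 2 by linarith
qed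

lemma gap_root:
  assumes "K > 0"
  obtains a where "a > 0" "gap (a, 0) = K"
proof -
  \<comment> \<open>Chosen so that \<open>ln t / (2 * pi) - 2 = K\<close>, which makes
    \<open>gap_lower_bound\<close> reach the level \<open>K\<close>.\<close>
  define t where "t = exp (2 * pi * (K + 2))"
  have t: "t > 0" by (simp add: t_def)
  have "ln t \<le> ln (1 + t)" using t by simp
  then have "K + 2 \<le> ln (1 + t) / (2 * pi)"
    by (simp add: t_def field_simps)
  then have "K \<le> gap (t\<^sup>2, 0)" using gap_lower_bound[OF t] by linarith
  moreover have "gap (0, 0) \<le> K" using assms by (simp add: gap_def)
  moreover have "continuous_on {0..t\<^sup>2} (\<lambda>a. gap (a, 0))"
    unfolding gap_def by (intro continuous_intros)
  ultimately obtain a where a: "0 \<le> a" "gap (a, 0) = K"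
    using IVT'[of "\<lambda>a. gap (a, 0)" 0 K "t\<^sup>2"] by auto
  with assms have "a \<noteq> 0" by (auto simp: gap_def)
  with a show ?thesis by (intro that[of a]) auto
qed

subsection \<open>The two phases\<close>

text \<open>The candidate has \<open>y = 0\<close> and \<open>x = t\<close>, where
  \<open>t \<le> sqrt a\<close> solves the stationarity equation. Monotonicity of \<open>gap\<close>
  then yields the inequality condition for \<open>y\<close>.\<close>

lemma peierls_delta_above:
  assumes "\<mu> > 0" "a > 0" and root: "gap (a, 0) = \<mu> / 2"
    and \<theta>: "2 * sin2_mean (a, 0) / \<mu> \<le> \<theta>"
  shows "peierls_delta \<mu> \<theta> = 0"
proof -
  \<comment> \<open>Stationarity in \<open>x\<close> at \<open>y = 0\<close>, solved for the
    temperature, reads \<open>f t = \<theta>\<close>. The intermediate value theorem applies between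
    \<open>1 / \<theta>\<close>, where \<open>f\<close> is at least \<open>\<theta>\<close>, and
    \<open>sqrt a\<close>, where it equals the critical value.\<close>
  define f where "f t = 1 / t + 2 * cos2_mean (t\<^sup>2, 0) / \<mu>" for t
  have \<theta>0: "\<theta> > 0"
    using sin2_mean_pos[of a] assms by (intro less_le_trans[OF _ \<theta>]) simp
  have "f (sqrt a) = 2 * sin2_mean (a, 0) / \<mu>"
    using root assms(1,2) by (simp add: f_def gap_def field_simps)
  then have f_root: "f (sqrt a) \<le> \<theta>" using \<theta> by simp
  then have "1 / sqrt a \<le> \<theta>"
    using cos2_mean_nonneg[of a] assms(1,2) unfolding f_def
    by (smt (verit) divide_nonneg_pos real_sqrt_pow2)
  then have le: "1 / \<theta> \<le> sqrt a" using \<theta>0 assms(2) by (simp add: field_simps)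
  have "\<theta> \<le> f (1 / \<theta>)"
    using assms(1) by (simp add: f_def cos2_mean_nonneg)
  moreover have "continuous_on {1 / \<theta>..sqrt a} f"
  proof -
    have "t \<noteq> 0" if "t \<in> {1 / \<theta>..sqrt a}" for t
      using that \<theta>0 by (auto simp: field_simps)
    then show ?thesis
      unfolding f_def using assms(1) by (intro continuous_intros) auto
  qed
  ultimately obtain t where t: "1 / \<theta> \<le> t" "t \<le> sqrt a" "f t = \<theta>"
    using IVT2'[of f "sqrt a" \<theta> "1 / \<theta>"] f_root le by blast
  have t0: "t > 0" using t(1) \<theta>0 by (meson less_le_trans zero_less_divide_1_iff)
  have t2: "t\<^sup>2 \<le> a"
    using t(2) t0 assms(2) by (metis power_mono real_sqrt_pow2 less_imp_le)
  have eq: "\<mu> * (\<theta> * t - 1) = 2 * t * cos2_mean (t\<^sup>2, 0)"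
    using t0 assms(1) by (simp add: t(3)[symmetric] f_def field_simps)
  have "t * (sin2_mean (t\<^sup>2, 0) - cos2_mean (t\<^sup>2, 0)) \<le> \<mu> / 2"
    using gap_mono[OF _ t2] t0 root by (simp add: gap_def)
  then have "t * (2 * sin2_mean (t\<^sup>2, 0)) \<le> t * (\<mu> * \<theta>)"
    using eq by (simp add: algebra_simps)
  then have "2 * sin2_mean (t\<^sup>2, 0) \<le> \<mu> * \<theta>" using t0 by simp
  then have "peierls_minimizer \<mu> \<theta> = (\<theta> * t, \<theta> * 0)"
    using assms(1) \<theta>0 t0 eq by (intro peierls_minimizer_eq) auto
  then show ?thesis by (simp add: peierls_delta_def)
qed

lemma peierls_delta_eq:
  assumes "\<mu> > 0" "\<theta> > 0" "fst z > 0" "snd z \<ge> 0"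
    and gap: "gap z = \<mu> / 2" and sin2: "sin2_mean z = \<mu> * \<theta> / 2"
  shows "peierls_delta \<mu> \<theta> = \<theta> * sqrt (snd z)"
proof -
  have z: "((sqrt (fst z))\<^sup>2, (sqrt (snd z))\<^sup>2) = z"
    using assms(3,4) by simp
  have "peierls_minimizer \<mu> \<theta> = (\<theta> * sqrt (fst z), \<theta> * sqrt (snd z))"
    using assms
    by (intro peierls_minimizer_eq) (simp_all only: z, auto simp: gap_def algebra_simps)
  then show ?thesis by (simp add: peierls_delta_def)
qed

text \<open>The inverse function theorem for \<open>(gap, sin2_mean)\<close>. The last clause is the
  lower right entry of the inverse Jacobian matrix, the only one that enters the slope of
  \<open>b\<close> in \<open>\<theta>\<close>.\<close>

lemma gap_sin2_mean_local_inverse: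
  assumes "a > 0"
  obtains g :: "real \<times> real \<Rightarrow> real \<times> real" and V h
  where "open V" "(gap (a, 0), sin2_mean (a, 0)) \<in> V" "g (gap (a, 0), sin2_mean (a, 0)) = (a, 0)"
    and "\<And>y. y \<in> V \<Longrightarrow> fst (g y) > 0 \<and> (gap (g y), sin2_mean (g y)) = y"
    and "(g has_derivative h) (at (gap (a, 0), sin2_mean (a, 0)))"
    and "\<And>k. snd (h (0, k)) = k * gap_dx (a, 0) /
           (gap_dx (a, 0) * sin2_dy (a, 0) - gap_dy (a, 0) * sin2_dx (a, 0))"
proof -
  let ?F = "\<lambda>z. (gap z, sin2_mean z)"
  let ?z = "(a, 0 :: real)"
  define E11 :: "(real \<times> real) \<Rightarrow>\<^sub>L (real \<times> real)" where "E11 = Blinfun (\<lambda>h. (fst h, 0))"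
  define E12 :: "(real \<times> real) \<Rightarrow>\<^sub>L (real \<times> real)" where "E12 = Blinfun (\<lambda>h. (snd h, 0))"
  define E21 :: "(real \<times> real) \<Rightarrow>\<^sub>L (real \<times> real)" where "E21 = Blinfun (\<lambda>h. (0, fst h))"
  define E22 :: "(real \<times> real) \<Rightarrow>\<^sub>L (real \<times> real)" where "E22 = Blinfun (\<lambda>h. (0, snd h))"
  have E [simp]: "blinfun_apply E11 = (\<lambda>h. (fst h, 0))" "blinfun_apply E12 = (\<lambda>h. (snd h, 0))"
    "blinfun_apply E21 = (\<lambda>h. (0, fst h))" "blinfun_apply E22 = (\<lambda>h. (0, snd h))"
    unfolding E11_def E12_def E21_def E22_def
    by (auto intro!: bounded_linear_Blinfun_apply bounded_linear_intros)
  define F' where "F' z = gap_dx z *\<^sub>R E11 + gap_dy z *\<^sub>R E12 + sin2_dx z *\<^sub>R E21 + sin2_dy z *\<^sub>R E22" for z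
  have F'_apply: "F' z h = (gap_dx z * fst h + gap_dy z * snd h, sin2_dx z * fst h + sin2_dy z * snd h)" for z h
    by (simp add: F'_def blinfun.bilinear_simps)
  define d where "d = gap_dx ?z * sin2_dy ?z - gap_dy ?z * sin2_dx ?z"
  \<comment> \<open>The first product in \<open>d\<close> is negative and the second positive, so no
    cancellation can occur.\<close>
  have "d < 0"
    using gap_dx_pos[OF assms] gap_dy_neg[OF assms] sin2_dx_neg[of ?z] sin2_dy_neg[of ?z]
      mult_pos_neg[of "gap_dx ?z" "sin2_dy ?z"] mult_neg_neg[of "gap_dy ?z" "sin2_dx ?z"]
    by (simp add: d_def)
  \<comment> \<open>The adjugate of the Jacobian matrix divided by its determinant, written in the
    matrix units \<open>E11\<close> to \<open>E22\<close>.\<close>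
  define G where "G = (1 / d) *\<^sub>R (sin2_dy ?z *\<^sub>R E11 - gap_dy ?z *\<^sub>R E12 - sin2_dx ?z *\<^sub>R E21 + gap_dx ?z *\<^sub>R E22)"
  have G_apply: "G k = ((sin2_dy ?z * fst k - gap_dy ?z * snd k) / d,
      (gap_dx ?z * snd k - sin2_dx ?z * fst k) / d)" for k
    by (simp add: G_def blinfun.bilinear_simps)
  have G: "G o\<^sub>L F' ?z = id_blinfun"
  proof (rule blinfun_eqI)
    fix h :: "real \<times> real"
    have "sin2_dy ?z * fst (F' ?z h) - gap_dy ?z * snd (F' ?z h) = d * fst h"
      "gap_dx ?z * snd (F' ?z h) - sin2_dx ?z * fst (F' ?z h) = d * snd h"
      by (simp_all add: F'_apply d_def algebra_simps)
    then have "(G o\<^sub>L F' ?z) h = ((d * fst h) / d, (d * snd h) / d)"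
      by (simp add: G_apply)
    then show "(G o\<^sub>L F' ?z) h = id_blinfun h" using \<open>d < 0\<close> by simp
  qed
  obtain U V g g' where inv: "open U" "U \<subseteq> {z. fst z > 0}" "?z \<in> U" "open V" "?F ?z \<in> V"
      "homeomorphism U V ?F g" "\<And>y. y \<in> V \<Longrightarrow> (g has_derivative (g' y)) (at y)"
      "\<And>y. y \<in> V \<Longrightarrow> g' y = inv (blinfun_apply (F' (g y)))"
      "\<And>y. y \<in> V \<Longrightarrow> bij (blinfun_apply (F' (g y)))"
  proof (rule inverse_function_theorem[of "{z. fst z > 0}" ?F F' ?z G])
    show "open {z :: real \<times> real. fst z > 0}"
      by (intro open_Collect_less continuous_intros)
    show "(?F has_derivative blinfun_apply (F' z)) (at z)" if "z \<in> {z. fst z > 0}" for z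
      using has_derivative_Pair[OF has_derivative_gap has_derivative_sin2_mean] that
      by (simp add: F'_apply[abs_def])
    show "continuous_on {z. fst z > 0} F'"
      unfolding F'_def
      by (intro continuous_intros continuous_on_gap_dx continuous_on_gap_dy
          continuous_on_sin2_dx continuous_on_sin2_dy)
  qed (use assms G in auto)
  have g: "g (?F ?z) = ?z" using homeomorphism_apply1[OF inv(6,3)] .
  show ?thesis
  proof (rule that[of V g "g' (?F ?z)"])
    show "open V" "?F ?z \<in> V" "g (?F ?z) = ?z" by (fact inv(4) inv(5) g)+
  next
    fix y assume "y \<in> V"
    then have "g y \<in> U" "?F (g y) = y"
      using inv(6) homeomorphism_apply2[OF inv(6)] by (auto simp: homeomorphism_def)
    then show "fst (g y) > 0 \<and> ?F (g y) = y" using inv(2) by auto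
  next
    show "(g has_derivative g' (?F ?z)) (at (?F ?z))" by (rule inv(7)[OF inv(5)])
  next
    fix k
    have "bij (F' ?z)" using inv(9)[OF inv(5)] g by simp
    then have "g' (?F ?z) (0, k) = G (0, k)"
      using G inv(8)[OF inv(5)] g
      by (metis bij_inv_eq_iff blinfun_apply_blinfun_compose blinfun_apply_id_blinfun)
    then show "snd (g' (?F ?z) (0, k)) = k * gap_dx (a, 0) /
           (gap_dx (a, 0) * sin2_dy (a, 0) - gap_dy (a, 0) * sin2_dx (a, 0))"
      by (simp add: G_apply d_def mult.commute)
  qed
qed

lemma peierls_delta_below:
  assumes "\<mu> > 0" "a > 0" and root: "gap (a, 0) = \<mu> / 2"
  defines "\<theta>c \<equiv> 2 * sin2_mean (a, 0) / \<mu>"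
  obtains C where "C > 0" "((\<lambda>\<theta>. peierls_delta \<mu> \<theta> / sqrt (\<theta>c - \<theta>)) \<longlongrightarrow> C) (at_left \<theta>c)"
proof -
  let ?z = "(a, 0 :: real)"
  have \<theta>c: "\<theta>c > 0" using sin2_mean_pos[of a] assms by (simp add: \<theta>c_def)
  have Fz: "(gap ?z, sin2_mean ?z) = (\<mu> / 2, \<mu> * \<theta>c / 2)"
    using assms by (simp add: \<theta>c_def)
  obtain g V h where g: "open V" "(\<mu> / 2, \<mu> * \<theta>c / 2) \<in> V" "g (\<mu> / 2, \<mu> * \<theta>c / 2) = ?z"
      "\<And>y. y \<in> V \<Longrightarrow> fst (g y) > 0 \<and> (gap (g y), sin2_mean (g y)) = y"
      "(g has_derivative h) (at (\<mu> / 2, \<mu> * \<theta>c / 2))"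
      "\<And>k. snd (h (0, k)) = k * gap_dx ?z / (gap_dx ?z * sin2_dy ?z - gap_dy ?z * sin2_dx ?z)"
    using gap_sin2_mean_local_inverse[OF assms(2)] unfolding Fz by metis
  \<comment> \<open>The curve \<open>gap = \<mu> / 2\<close> parametrized by temperature; it passes
    through \<open>(a, 0)\<close> at \<open>\<theta>c\<close>.\<close>
  define p where "p \<theta> = g (\<mu> / 2, \<mu> * \<theta> / 2)" for \<theta>
  \<comment> \<open>The slope of \<open>snd (p \<theta>)\<close> at \<open>\<theta>c\<close>; the
    factor \<open>\<mu> / 2\<close> comes from the chain rule for
    \<open>\<mu> * \<theta> / 2\<close>.\<close>
  define \<beta> where "\<beta> = \<mu> / 2 * gap_dx ?z / (gap_dx ?z * sin2_dy ?z - gap_dy ?z * sin2_dx ?z)"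
  have "gap_dx ?z * sin2_dy ?z - gap_dy ?z * sin2_dx ?z < 0"
    using gap_dx_pos[OF assms(2)] gap_dy_neg[OF assms(2)] sin2_dx_neg[of ?z] sin2_dy_neg[of ?z]
      mult_pos_neg[of "gap_dx ?z" "sin2_dy ?z"] mult_neg_neg[of "gap_dy ?z" "sin2_dx ?z"]
    by simp
  then have \<beta>: "\<beta> < 0"
    using gap_dx_pos[OF assms(2)] assms(1) by (simp add: \<beta>_def divide_pos_neg)
  have line: "((\<lambda>\<theta>. (\<mu> / 2, \<mu> * \<theta> / 2)) has_derivative (\<lambda>k. (0, \<mu> * k / 2))) (at \<theta>c)"
    by (auto intro!: derivative_eq_intros)
  have "((\<lambda>\<theta>. snd (p \<theta>)) has_derivative (\<lambda>k. snd (h (0, \<mu> * k / 2)))) (at \<theta>c)"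
    unfolding p_def by (rule has_derivative_snd[OF has_derivative_compose[OF line g(5)]])
  then have "((\<lambda>\<theta>. snd (p \<theta>)) has_real_derivative \<beta>) (at \<theta>c)"
    unfolding has_field_derivative_def
    by (rule has_derivative_eq_rhs) (simp add: g(6) \<beta>_def fun_eq_iff)
  moreover have flip: "x / (\<theta>c - \<theta>) = - (x / (\<theta> - \<theta>c))" for x \<theta>
    by (metis minus_diff_eq minus_divide_right)
  ultimately have "((\<lambda>\<theta>. - (snd (p \<theta>) / (\<theta> - \<theta>c))) \<longlongrightarrow> - \<beta>) (at_left \<theta>c)"
    by (intro tendsto_minus) (auto simp: has_field_derivative_iff filterlim_at_split p_def g(3))
  then have lim: "((\<lambda>\<theta>. snd (p \<theta>) / (\<theta>c - \<theta>)) \<longlongrightarrow> - \<beta>) (at_left \<theta>c)"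
    by (simp only: flip)
  have "isCont (\<lambda>\<theta>. (\<mu> / 2, \<mu> * \<theta> / 2)) \<theta>c"
    by (intro continuous_intros) auto
  then have "\<forall>\<^sub>F \<theta> in at \<theta>c. (\<mu> / 2, \<mu> * \<theta> / 2) \<in> V"
    using g(1,2) by (auto simp: isCont_def intro: topological_tendstoD)
  then have V: "\<forall>\<^sub>F \<theta> in at_left \<theta>c. (\<mu> / 2, \<mu> * \<theta> / 2) \<in> V"
    by (simp add: eventually_at_split)
  have "((\<lambda>\<theta>. \<theta> * sqrt (snd (p \<theta>) / (\<theta>c - \<theta>))) \<longlongrightarrow> \<theta>c * sqrt (- \<beta>)) (at_left \<theta>c)"
    by (intro tendsto_intros lim)
  \<comment> \<open>The limit \<open>- \<beta>\<close> is positive, so the curve has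
    \<open>b > 0\<close> just below \<open>\<theta>c\<close> and is admissible there:
    \<open>peierls_delta_eq\<close> identifies it with the minimizer.\<close>
  moreover have pos: "\<forall>\<^sub>F \<theta> in at_left \<theta>c. 0 < snd (p \<theta>) / (\<theta>c - \<theta>)"
    using order_tendstoD(1)[OF lim, of 0] \<beta> by simp
  have "\<forall>\<^sub>F \<theta> in at_left \<theta>c.
      \<theta> * sqrt (snd (p \<theta>) / (\<theta>c - \<theta>)) = peierls_delta \<mu> \<theta> / sqrt (\<theta>c - \<theta>)"
    using V pos eventually_at_left_real[OF \<theta>c]
  proof eventually_elim
    case (elim \<theta>)
    then have \<theta>: "0 < \<theta>" "\<theta> < \<theta>c" by auto
    with elim(2) have "snd (p \<theta>) > 0" by (simp add: zero_less_divide_iff)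
    then have "peierls_delta \<mu> \<theta> = \<theta> * sqrt (snd (p \<theta>))"
      using g(4)[OF elim(1)] \<theta>(1) assms(1) by (intro peierls_delta_eq) (auto simp: p_def)
    then show ?case by (simp add: real_sqrt_divide)
  qed
  ultimately have "((\<lambda>\<theta>. peierls_delta \<mu> \<theta> / sqrt (\<theta>c - \<theta>)) \<longlongrightarrow> \<theta>c * sqrt (- \<beta>)) (at_left \<theta>c)"
    by (rule Lim_transform_eventually)
  with \<theta>c \<beta> show ?thesis by (intro that[of "\<theta>c * sqrt (- \<beta>)"]) auto
qed

theorem theorem1p5:
  fixes \<mu> :: real
  assumes "\<mu> > 0"
  shows "\<exists>C>0. (\<lambda>\<theta>. peierls_delta \<mu> \<theta> - C * sqrt (max (critical_temperature \<mu> - \<theta>) 0))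
           \<in> o[at (critical_temperature \<mu>)](\<lambda>\<theta>. sqrt (max (critical_temperature \<mu> - \<theta>) 0))"
proof -
  obtain a where a: "a > 0" "gap (a, 0) = \<mu> / 2"
    using gap_root[of "\<mu> / 2"] assms by auto
  define \<theta>c where "\<theta>c = 2 * sin2_mean (a, 0) / \<mu>"
  have \<theta>c: "\<theta>c > 0" using sin2_mean_pos[of a] a assms by (simp add: \<theta>c_def)
  have above: "peierls_delta \<mu> \<theta> = 0" if "\<theta>c \<le> \<theta>" for \<theta>
    using peierls_delta_above[OF assms a] that by (simp add: \<theta>c_def)
  obtain C where C: "C > 0" "((\<lambda>\<theta>. peierls_delta \<mu> \<theta> / sqrt (\<theta>c - \<theta>)) \<longlongrightarrow> C) (at_left \<theta>c)"
    using peierls_delta_below[OF assms a] unfolding \<theta>c_def by blast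
  have "critical_temperature \<mu> = \<theta>c"
    unfolding critical_temperature_def
  proof (rule cInf_eq_minimum)
    show "\<theta>c \<in> {\<theta>. 0 < \<theta> \<and> (\<forall>\<theta>'\<ge>\<theta>. peierls_delta \<mu> \<theta>' = 0)}"
      using \<theta>c above by simp
  next
    fix \<theta> assume \<theta>: "\<theta> \<in> {\<theta>. 0 < \<theta> \<and> (\<forall>\<theta>'\<ge>\<theta>. peierls_delta \<mu> \<theta>' = 0)}"
    show "\<theta>c \<le> \<theta>"
    \<comment> \<open>A smaller member would force \<open>\<delta> = 0\<close> immediately below
      \<open>\<theta>c\<close>, against the positive limit \<open>C\<close> of the quotient.\<close>
    proof (rule ccontr)
      assume "\<not> \<theta>c \<le> \<theta>"
      then have "\<forall>\<^sub>F \<theta>' in at_left \<theta>c. \<theta>' \<in> {\<theta><..<\<theta>c}"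
        by (intro eventually_at_left_real) simp
      with order_tendstoD(1)[OF C(2,1)] have "\<forall>\<^sub>F \<theta>' in at_left \<theta>c. False"
        by eventually_elim (use \<theta> in auto)
      then show False by simp
    qed
  qed
  moreover have "(\<lambda>\<theta>. peierls_delta \<mu> \<theta> - C * sqrt (max (\<theta>c - \<theta>) 0))
      \<in> o[at \<theta>c](\<lambda>\<theta>. sqrt (max (\<theta>c - \<theta>) 0))"
  proof (rule landau_o.smallI)
    fix c :: real assume "c > 0"
    \<comment> \<open>To the right both sides vanish; to the left the estimate is the limit
      \<open>C\<close> multiplied by \<open>sqrt (\<theta>c - \<theta>)\<close>.\<close>
    have "\<forall>\<^sub>F \<theta> in at_right \<theta>c. norm (peierls_delta \<mu> \<theta> - C * sqrt (max (\<theta>c - \<theta>) 0))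
        \<le> c * norm (sqrt (max (\<theta>c - \<theta>) 0))"
      using eventually_at_right_less[of \<theta>c] by eventually_elim (simp add: above)
    moreover have "\<forall>\<^sub>F \<theta> in at_left \<theta>c. norm (peierls_delta \<mu> \<theta> - C * sqrt (max (\<theta>c - \<theta>) 0))
        \<le> c * norm (sqrt (max (\<theta>c - \<theta>) 0))"
      using tendstoD[OF C(2) \<open>c > 0\<close>] eventually_at_left_real[OF \<theta>c]
    proof eventually_elim
      case (elim \<theta>)
      define r where "r = sqrt (\<theta>c - \<theta>)"
      have r: "r > 0" using elim(2) by (simp add: r_def)
      have "\<bar>peierls_delta \<mu> \<theta> - C * r\<bar> = r * \<bar>peierls_delta \<mu> \<theta> / r - C\<bar>"
        using r by (simp add: abs_mult_pos[symmetric] field_simps flip: abs_mult_pos')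
      also have "\<dots> \<le> r * c"
        using elim(1) r by (intro mult_left_mono) (auto simp: dist_real_def r_def)
      finally show ?case
        using elim(2) r by (simp add: r_def mult.commute)
    qed
    ultimately show "\<forall>\<^sub>F \<theta> in at \<theta>c. norm (peierls_delta \<mu> \<theta> - C * sqrt (max (\<theta>c - \<theta>) 0))
        \<le> c * norm (sqrt (max (\<theta>c - \<theta>) 0))"
      by (simp add: eventually_at_split)
  qed
  ultimately show ?thesis using C(1) by auto
qed

end
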